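(* Consider the controlled-leader system $$\frac{d}{dt}y_0(t)=u(t)\in\mathbb{R}^d,\quad t>0,$$ $$\frac{d}{dt}x_i(t)=\frac1N\sum_{j\ne i}\chi_{ij}\,b_{ij}(t)\,\big(x_j(t-\tau_{ij})-x_i(t)\big)+\frac{c_{i0}(t)}{N}\,\big(y_0(t-\tau_{i0})-x_i(t)\big),\quad t>0,\ i=1,\dots,N,$$ with initial conditions $y_0(t)=y^0(t)$ and $x_i(t)=x_i^0(t)$ for $t\in[-\tau,0]$, $i=1,\dots,N$, and let $\bar x\in\mathbb{R}^d$. Then there exists an admissible control strategy $u:[0,+\infty)\to\mathbb{R}^d$ such that the leader $y_0$ reaches $\bar x$ in finite time, i.e. there exists $t_0>0$ such that $y_0(t)=\bar x$ for all $t\ge t_0$, and every corresponding solution satisfies $$d(t)\le C^*e^{-\gamma^* t}\quad\text{for all } t\ge t_0,$$ for suitable positive constants $\gamma^*$ and $C^*$.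
   Context: Let $N\ge3$ be an integer, let $\mathbb{R}^d$ carry the Euclidean norm $|\cdot|$; $x_i(t)\in\mathbb{R}^d$, $i=1,\dots,N$, are the opinions of the non-leaders and $y_0(t)\in\mathbb{R}^d$ is the opinion of the leader. The delays $\tau_{ij}$ ($i,j=1,\dots,N$) and $\tau_{i0}$ ($i=1,\dots,N$) are positive constants and $\tau:=\max\{\max_{i,j=1,\dots,N}\tau_{ij},\max_{i=1,\dots,N}\tau_{i0}\}$. The coefficients $\chi_{ij}\in\{0,1\}$ are arbitrary ($\chi_{ij}=1$ if $j$ transmits information to $i$, $0$ otherwise). The weights are $b_{ij}(t):=\psi_{ij}(x_i(t),x_j(t-\tau_{ij}))$ and $c_{i0}(t):=\phi_{0i}(x_i(t),y_0(t))$, where $\psi_{ij},\phi_{0i}:\mathbb{R}^d\times\mathbb{R}^d\to\mathbb{R}$ are continuous, positive and bounded. The initial data $x_i^0,y^0:[-\tau,0]\to\mathbb{R}^d$ are continuous. A constant $M>0$ is fixed, and a Lebesgue measurable control $u(\cdot)$ is called admissible if $\|u\|_\infty\le M$. Solutions are continuous on $[-\tau,\infty)$ and agree with the initial data on $[-\tau,0]$; the equation for $y_0$ is understood for almost every $t>0$ with $y_0$ absolutely continuous on bounded intervals of $[0,\infty)$. Notation: $d(t):=\max\Big\{\max_{i=1,\dots,N}|x_i(t)-y_0(t)|,\ \max_{i,j=1,\dots,N}|x_i(t)-x_j(t)|\Big\}$. *)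

theory Defs
  imports "HOL-Analysis.Analysis"
begin

(* The epsilon-delta notion for functions of a real variable; the library constant
   absolutely_continuous is about pairs of measures. Degenerate intervals a k = b k are
   harmless, as they contribute 0 to both sums. *)
definition abs_continuous_on :: "real \<Rightarrow> real \<Rightarrow> (real \<Rightarrow> 'a::real_normed_vector) \<Rightarrow> bool" where
  "abs_continuous_on p q f \<longleftrightarrow>
     (\<forall>\<epsilon>>0. \<exists>\<delta>>0. \<forall>(n::nat) a b.
        (\<forall>k<n. p \<le> a k \<and> a k \<le> b k \<and> b k \<le> q) \<and>
        (\<forall>k<n. \<forall>l<n. k \<noteq> l \<longrightarrow> {a k<..<b k} \<inter> {a l<..<b l} = {}) \<and>
        (\<Sum>k<n. b k - a k) < \<delta>
        \<longrightarrow> (\<Sum>k<n. norm (f (b k) - f (a k))) < \<epsilon>)"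

(* Non-leaders are indexed by 1,...,N. The delays of the leader's opinion, written with
   second index 0 in the literature, are kept in a separate function \<tau>0. *)
definition max_delay :: "nat \<Rightarrow> (nat \<Rightarrow> nat \<Rightarrow> real) \<Rightarrow> (nat \<Rightarrow> real) \<Rightarrow> real" where
  "max_delay N \<tau> \<tau>0 =
     max (Max ((\<lambda>(i, j). \<tau> i j) ` ({1..N} \<times> {1..N}))) (Max (\<tau>0 ` {1..N}))"

(* The second conjunct is the essential supremum bound on [0,\<infinity>). *)
definition admissible :: "real \<Rightarrow> (real \<Rightarrow> real ^ 'd) \<Rightarrow> bool" where
  "admissible M u \<longleftrightarrow>
     u \<in> borel_measurable (lebesgue_on {0..}) \<and>
     (AE t in lebesgue_on {0..}. norm (u t) \<le> M)"

(* In the next two definitions r is the maximal delay, so that [-r,0] carries the initial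
   data; values of trajectories before time -r are irrelevant. *)
definition leader_trajectory ::
  "real \<Rightarrow> (real \<Rightarrow> real ^ 'd) \<Rightarrow> (real \<Rightarrow> real ^ 'd) \<Rightarrow> (real \<Rightarrow> real ^ 'd) \<Rightarrow> bool" where
  "leader_trajectory r u yinit y \<longleftrightarrow>
     continuous_on {-r..} y \<and>
     (\<forall>t\<in>{-r..0}. y t = yinit t) \<and>
     (\<forall>T>0. abs_continuous_on 0 T y) \<and>
     (AE t in lebesgue_on {0<..}. (y has_vector_derivative u t) (at t))"

definition follower_trajectories ::
  "nat \<Rightarrow> real \<Rightarrow> (nat \<Rightarrow> nat \<Rightarrow> real) \<Rightarrow> (nat \<Rightarrow> real) \<Rightarrow> (nat \<Rightarrow> nat \<Rightarrow> real)
   \<Rightarrow> (nat \<Rightarrow> nat \<Rightarrow> (real ^ 'd) \<times> (real ^ 'd) \<Rightarrow> real) \<Rightarrow> (nat \<Rightarrow> (real ^ 'd) \<times> (real ^ 'd) \<Rightarrow> real)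
   \<Rightarrow> (nat \<Rightarrow> real \<Rightarrow> real ^ 'd) \<Rightarrow> (real \<Rightarrow> real ^ 'd) \<Rightarrow> (nat \<Rightarrow> real \<Rightarrow> real ^ 'd) \<Rightarrow> bool" where
  "follower_trajectories N r \<tau> \<tau>0 chi \<psi> \<phi> xinit y x \<longleftrightarrow>
     (\<forall>i\<in>{1..N}.
        continuous_on {-r..} (x i) \<and>
        (\<forall>t\<in>{-r..0}. x i t = xinit i t) \<and>
        (\<forall>t>0. (x i has_vector_derivative
            ((1 / real N) *\<^sub>R (\<Sum>j\<in>{1..N} - {i}.
                (chi i j * \<psi> i j (x i t, x j (t - \<tau> i j))) *\<^sub>R (x j (t - \<tau> i j) - x i t))
             + (\<phi> i (x i t, y t) / real N) *\<^sub>R (y (t - \<tau>0 i) - x i t))) (at t)))"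

definition opinion_diameter ::
  "nat \<Rightarrow> (real \<Rightarrow> real ^ 'd) \<Rightarrow> (nat \<Rightarrow> real \<Rightarrow> real ^ 'd) \<Rightarrow> real \<Rightarrow> real" where
  "opinion_diameter N y x t =
     max (Max ((\<lambda>i. norm (x i t - y t)) ` {1..N}))
         (Max ((\<lambda>(i, j). norm (x i t - x j t)) ` ({1..N} \<times> {1..N})))"

end

(* Steer the leader towards xbar at constant speed M and stop there. Absolutely continuous
   functions with almost everywhere vanishing derivative are constant, so this is the only
   leader trajectory driven by the control. Once the leader is at rest, only its attraction on
   every follower matters. At a first time at which a follower touches a barrier
   W = D exp(-gamma t), all delayed opinions lie within exp(gamma r) W of xbar, so the other
   followers push outwards at relative rate at most K (exp(gamma r) - 1), whereas the leader
   pulls inwards at relative rate at least mu / N, where mu > 0 bounds the continuous positive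
   leader weights from below on a ball that the followers do not leave. For small gamma the pull
   wins, so the barrier is never crossed. The same argument with the barrier R exp(t) bounds the
   followers until the leader has been at rest for the maximal delay, uniformly over all
   solutions. *)
theory Submission
  imports Defs
begin

section \<open>Absolute continuity on an interval\<close>

text \<open>The definition numbers its intervals by an initial segment of the naturals, whereas a
  tagged division is a finite set of pairs. Reindexing along a bijection with
  \<open>{..<card I}\<close> makes the same \<open>\<delta>\<close> work for every finite index
  set.\<close>

lemma abs_continuous_on_finite_family:
  fixes f :: "real \<Rightarrow> 'a::real_normed_vector"
  assumes "abs_continuous_on p q f" "\<epsilon> > 0"
  shows "\<exists>\<delta>>0. \<forall>(I :: 'i set) a b. finite I \<and> (\<forall>i\<in>I. p \<le> a i \<and> a i \<le> b i \<and> b i \<le> q) \<and>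
       disjoint_family_on (\<lambda>i. {a i<..<b i}) I \<and> (\<Sum>i\<in>I. b i - a i) < \<delta>
       \<longrightarrow> (\<Sum>i\<in>I. norm (f (b i) - f (a i))) < \<epsilon>"
proof -
  obtain \<delta> where "\<delta> > 0" and \<delta>: "\<And>(n::nat) a b.
        \<lbrakk>\<forall>k<n. p \<le> a k \<and> a k \<le> b k \<and> b k \<le> q;
        \<forall>k<n. \<forall>l<n. k \<noteq> l \<longrightarrow> {a k<..<b k} \<inter> {a l<..<b l} = {};
        (\<Sum>k<n. b k - a k) < \<delta>\<rbrakk>
        \<Longrightarrow> (\<Sum>k<n. norm (f (b k) - f (a k))) < \<epsilon>"
    using assms(1)[unfolded abs_continuous_on_def, THEN spec, THEN mp, OF assms(2)] by blast
  have key: "(\<Sum>i\<in>I. norm (f (b i) - f (a i))) < \<epsilon>"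
    if I_ab: "finite I \<and> (\<forall>i\<in>I. p \<le> a i \<and> a i \<le> b i \<and> b i \<le> q) \<and>
       disjoint_family_on (\<lambda>i. {a i<..<b i}) I \<and> (\<Sum>i\<in>I. b i - a i) < \<delta>"
    for I :: "'i set" and a b
  proof -
    have I: "finite I" and ab: "\<And>i. i \<in> I \<Longrightarrow> p \<le> a i \<and> a i \<le> b i \<and> b i \<le> q"
      and disj: "disjoint_family_on (\<lambda>i. {a i<..<b i}) I" and len: "(\<Sum>i\<in>I. b i - a i) < \<delta>"
      using I_ab by simp_all
    obtain h where h: "bij_betw h {..<card I} I"
      using ex_bij_betw_nat_finite[OF I] by (auto simp: atLeast0LessThan)
    have hI: "h k \<in> I" if "k < card I" for k
      using h that by (auto simp: bij_betw_def)
    have hinj: "h k \<noteq> h l" if "k < card I" "l < card I" "k \<noteq> l" for k l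
      using h that by (auto simp: bij_betw_def inj_on_def)
    have "(\<Sum>k<card I. norm (f (b (h k)) - f (a (h k)))) < \<epsilon>"
    proof (rule \<delta>)
      show "\<forall>k<card I. \<forall>l<card I. k \<noteq> l \<longrightarrow> {a (h k)<..<b (h k)} \<inter> {a (h l)<..<b (h l)} = {}"
        using disj hI hinj unfolding disjoint_family_on_def by blast
      show "(\<Sum>k<card I. b (h k) - a (h k)) < \<delta>"
        using len sum.reindex_bij_betw[OF h, of "\<lambda>i. b i - a i"] by simp
    qed (use ab hI in blast)
    then show ?thesis
      using sum.reindex_bij_betw[OF h, of "\<lambda>i. norm (f (b i) - f (a i))"] by simp
  qed
  show ?thesis
    by (intro exI[of _ \<delta>] conjI[OF \<open>\<delta> > 0\<close>] allI impI key)
qed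

lemma abs_continuous_on_diff:
  fixes f g :: "real \<Rightarrow> 'a::real_normed_vector"
  assumes "abs_continuous_on p q f" "abs_continuous_on p q g"
  shows "abs_continuous_on p q (\<lambda>t. f t - g t)"
  unfolding abs_continuous_on_def
proof (intro allI impI)
  fix \<epsilon> :: real assume "\<epsilon> > 0"
  then have e: "\<epsilon> / 2 > 0" by simp
  obtain d1 where d1: "d1 > 0" "\<forall>(I :: nat set) a b. finite I \<and> (\<forall>i\<in>I. p \<le> a i \<and> a i \<le> b i \<and> b i \<le> q) \<and>
       disjoint_family_on (\<lambda>i. {a i<..<b i}) I \<and> (\<Sum>i\<in>I. b i - a i) < d1
       \<longrightarrow> (\<Sum>i\<in>I. norm (f (b i) - f (a i))) < \<epsilon> / 2"
    using abs_continuous_on_finite_family[OF assms(1) e] by blast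
  obtain d2 where d2: "d2 > 0" "\<forall>(I :: nat set) a b. finite I \<and> (\<forall>i\<in>I. p \<le> a i \<and> a i \<le> b i \<and> b i \<le> q) \<and>
       disjoint_family_on (\<lambda>i. {a i<..<b i}) I \<and> (\<Sum>i\<in>I. b i - a i) < d2
       \<longrightarrow> (\<Sum>i\<in>I. norm (g (b i) - g (a i))) < \<epsilon> / 2"
    using abs_continuous_on_finite_family[OF assms(2) e] by blast
  have "(\<Sum>k<n. norm (f (b k) - g (b k) - (f (a k) - g (a k)))) < \<epsilon>"
    if "(\<forall>k<n. p \<le> a k \<and> a k \<le> b k \<and> b k \<le> q) \<and>
        (\<forall>k<n. \<forall>l<n. k \<noteq> l \<longrightarrow> {a k<..<b k} \<inter> {a l<..<b l} = {}) \<and>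
        (\<Sum>k<n. b k - a k) < min d1 d2" for n :: nat and a b
  proof -
    have "norm (f (b k) - g (b k) - (f (a k) - g (a k)))
        \<le> norm (f (b k) - f (a k)) + norm (g (b k) - g (a k))" for k
      using norm_triangle_ineq4[of "f (b k) - f (a k)" "g (b k) - g (a k)"]
      by (simp add: algebra_simps)
    then have "(\<Sum>k<n. norm (f (b k) - g (b k) - (f (a k) - g (a k))))
        \<le> (\<Sum>k<n. norm (f (b k) - f (a k))) + (\<Sum>k<n. norm (g (b k) - g (a k)))"
      by (simp add: sum_mono flip: sum.distrib)
    also have "\<dots> < \<epsilon> / 2 + \<epsilon> / 2"
      using that by (intro add_strict_mono d1(2)[THEN spec, THEN spec, THEN spec, THEN mp] d2(2)[THEN spec, THEN spec, THEN spec, THEN mp])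
        (auto simp: disjoint_family_on_def)
    finally show ?thesis by simp
  qed
  then show "\<exists>\<delta>>0. \<forall>(n::nat) a b.
        (\<forall>k<n. p \<le> a k \<and> a k \<le> b k \<and> b k \<le> q) \<and>
        (\<forall>k<n. \<forall>l<n. k \<noteq> l \<longrightarrow> {a k<..<b k} \<inter> {a l<..<b l} = {}) \<and>
        (\<Sum>k<n. b k - a k) < \<delta>
        \<longrightarrow> (\<Sum>k<n. norm (f (b k) - g (b k) - (f (a k) - g (a k)))) < \<epsilon>"
    using d1(1) d2(1) by (intro exI[of _ "min d1 d2"]) auto
qed

lemma lipschitz_on_imp_abs_continuous_on:
  fixes f :: "real \<Rightarrow> 'a::real_normed_vector"
  assumes "L-lipschitz_on {p..q} f"
  shows "abs_continuous_on p q f"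
  unfolding abs_continuous_on_def
proof (intro allI impI)
  fix \<epsilon> :: real assume "\<epsilon> > 0"
  have "L \<ge> 0" using assms by (rule lipschitz_on_nonneg)
  \<comment> \<open>Dividing by \<open>L + 1\<close> rather than \<open>L\<close> covers the case
    \<open>L = 0\<close> as well.\<close>
  have "(\<Sum>k<n. norm (f (b k) - f (a k))) < \<epsilon>"
    if "(\<forall>k<n. p \<le> a k \<and> a k \<le> b k \<and> b k \<le> q)" and len: "(\<Sum>k<n. b k - a k) < \<epsilon> / (L + 1)"
    for n :: nat and a b
  proof -
    have "norm (f (b k) - f (a k)) \<le> L * (b k - a k)" if "k < n" for k
      using lipschitz_onD[OF assms, of "b k" "a k"] \<open>\<forall>k<n. _ k\<close> that
      by (auto simp: dist_norm)
    then have "(\<Sum>k<n. norm (f (b k) - f (a k))) \<le> L * (\<Sum>k<n. b k - a k)"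
      by (auto simp: sum_distrib_left intro: sum_mono)
    also have "\<dots> \<le> (L + 1) * (\<Sum>k<n. b k - a k)"
      using that by (intro mult_right_mono sum_nonneg) auto
    also have "\<dots> < \<epsilon>"
      using len \<open>L \<ge> 0\<close> by (simp add: pos_less_divide_eq mult.commute)
    finally show ?thesis .
  qed
  then show "\<exists>\<delta>>0. \<forall>(n::nat) a b.
        (\<forall>k<n. p \<le> a k \<and> a k \<le> b k \<and> b k \<le> q) \<and>
        (\<forall>k<n. \<forall>l<n. k \<noteq> l \<longrightarrow> {a k<..<b k} \<inter> {a l<..<b l} = {}) \<and>
        (\<Sum>k<n. b k - a k) < \<delta>
        \<longrightarrow> (\<Sum>k<n. norm (f (b k) - f (a k))) < \<epsilon>"
    using \<open>\<epsilon> > 0\<close> \<open>L \<ge> 0\<close> by (intro exI[of _ "\<epsilon> / (L + 1)"]) auto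
qed

text \<open>The Cantor function shows that an almost everywhere vanishing derivative alone is not
  enough. Cousin's lemma, in the form of a division fine for a gauge, takes the place of a Vitali
  covering: it yields \<open>e * (1 + (b - a))\<close> as a bound for the total increment, for every
  \<open>e > 0\<close>.\<close>

lemma abs_continuous_on_zero_derivative:
  fixes f :: "real \<Rightarrow> 'a::real_normed_vector"
  assumes "a \<le> b" and ac: "abs_continuous_on a b f" and "negligible S"
    and deriv: "\<And>x. x \<in> {a..b} - S \<Longrightarrow> (f has_vector_derivative 0) (at x within {a..b})"
  shows "f b = f a"
proof -
  have bound: "norm (f b - f a) \<le> e * (1 + (b - a))" if "e > 0" for e
  proof -
    obtain \<delta> where "\<delta> > 0" and \<delta>: "\<forall>(I :: (real \<times> real set) set) u v. finite I \<and> (\<forall>i\<in>I. a \<le> u i \<and> u i \<le> v i \<and> v i \<le> b) \<and>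
       disjoint_family_on (\<lambda>i. {u i<..<v i}) I \<and> (\<Sum>i\<in>I. v i - u i) < \<delta>
       \<longrightarrow> (\<Sum>i\<in>I. norm (f (v i) - f (u i))) < e"
      using abs_continuous_on_finite_family[OF ac \<open>e > 0\<close>] by blast
    have S: "S \<in> sets lebesgue"
      using \<open>negligible S\<close> by (auto simp: negligible_iff_null_sets)
    \<comment> \<open>Outer regularity: the null set \<open>S\<close> is enclosed in an open set
      whose measure stays below the \<open>\<delta>\<close> that absolute continuity supplies for
      \<open>e\<close>.\<close>
    obtain T where T: "open T" "S \<subseteq> T" "T - S \<in> lmeasurable" "emeasure lebesgue (T - S) < ennreal \<delta>"
      using sets_lebesgue_outer_open[OF S \<open>\<delta> > 0\<close>] by metis
    have T_eq: "T = (T - S) \<union> S" using T(2) by auto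
    have Tm: "T \<in> lmeasurable"
      by (subst T_eq) (intro fmeasurable.Un T(3) negligible_imp_measurable \<open>negligible S\<close>)
    have "emeasure lebesgue T < ennreal \<delta>"
      using T(3,4) \<open>negligible S\<close> emeasure_Un_null_set[of "T - S" lebesgue S] T_eq
      by (metis fmeasurableD negligible_iff_null_sets)
    then have mT: "measure lebesgue T < \<delta>"
      using \<open>\<delta> > 0\<close> Tm by (simp add: emeasure_eq_measure2 ennreal_less_iff)
    have "\<exists>d>0. \<forall>y\<in>{a..b}. \<bar>y - x\<bar> < d \<longrightarrow> norm (f y - f x) \<le> e * \<bar>y - x\<bar>"
      if "x \<in> {a..b} - S" for x
      using deriv[OF that] \<open>e > 0\<close>
      unfolding has_vector_derivative_def has_derivative_within_alt by auto
    then obtain r where r: "\<And>x. x \<in> {a..b} - S \<Longrightarrow>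
        r x > 0 \<and> (\<forall>y\<in>{a..b}. \<bar>y - x\<bar> < r x \<longrightarrow> norm (f y - f x) \<le> e * \<bar>y - x\<bar>)"
      by metis
    \<comment> \<open>On a division fine for this gauge, the intervals tagged in \<open>S\<close> have total length
      below \<open>\<delta>\<close>, and on the others \<open>f\<close> grows at rate at most \<open>e\<close>.\<close>
    define g where "g x = (if x \<in> S then T else if x \<in> {a..b} then ball x (r x) else ball x 1)" for x
    \<comment> \<open>The third case of \<open>g\<close> only makes it a gauge on the whole line;
      the tags of the division below lie in \<open>{a..b}\<close>.\<close>
    have "gauge g"
      unfolding gauge_def g_def using r T by auto
    then obtain p where p: "p tagged_division_of {a..b}" "g fine p"
      using fine_division_exists_real by blast
    have finp: "finite p" using p(1) by blast
    have K: "\<exists>u v. K = {u..v} \<and> u \<le> x \<and> x \<le> v \<and> a \<le> u \<and> v \<le> b" if xK: "(x, K) \<in> p" for x K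
    proof -
      obtain u v where "K = {u..v}" using tagged_division_ofD(4)[OF p(1) xK] by auto
      moreover have "x \<in> K" "K \<subseteq> {a..b}" using tagged_division_ofD(2,3)[OF p(1) xK] by auto
      ultimately show ?thesis by auto
    qed
    have InfSup: "K = {Inf K..Sup K} \<and> Inf K \<le> x \<and> x \<le> Sup K \<and> a \<le> Inf K \<and> Sup K \<le> b"
      if "(x, K) \<in> p" for x K
      using K[OF that] by force
    define l u where "l i = Inf (snd i)" and "u i = Sup (snd i)" for i :: "real \<times> real set"
    have lu: "snd i = {l i..u i}" "l i \<le> fst i" "fst i \<le> u i" "a \<le> l i" "u i \<le> b" if "i \<in> p" for i
      using InfSup[of "fst i" "snd i"] that by (auto simp: l_def u_def)
    have lu_le: "l i \<le> u i" if "i \<in> p" for i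
      using lu(2,3)[OF that] by linarith
    have disj: "disjoint_family_on (\<lambda>i. {l i<..<u i}) p"
      unfolding disjoint_family_on_def
    proof (intro ballI impI)
      fix i j assume ij: "i \<in> p" "j \<in> p" "i \<noteq> j"
      then have "interior (snd i) \<inter> interior (snd j) = {}"
        using tagged_division_ofD(5)[OF p(1), of "fst i" "snd i" "fst j" "snd j"]
        by (metis prod.collapse)
      then show "{l i<..<u i} \<inter> {l j<..<u j} = {}"
        using lu(1)[OF ij(1)] lu(1)[OF ij(2)] by simp
    qed
    \<comment> \<open>Used for \<open>f\<close>, where it gives the total increment, and for the
      identity, where it gives the total length.\<close>
    have tele: "(\<Sum>i\<in>p. h (u i) - h (l i)) = h b - h a" for h :: "real \<Rightarrow> 'b::real_normed_vector"
      using additive_tagged_division_1[OF \<open>a \<le> b\<close> p(1), of h] by (simp add: l_def u_def case_prod_beta)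
    let ?P = "{i \<in> p. fst i \<in> S}"
    have "(\<Sum>i\<in>?P. norm (f (u i) - f (l i))) < e"
    proof (rule \<delta>[THEN spec, THEN spec, THEN spec, THEN mp], intro conjI)
      show dP: "disjoint_family_on (\<lambda>i. {l i<..<u i}) ?P"
        by (rule disjoint_family_on_mono[OF _ disj]) auto
      have "(\<Sum>i\<in>?P. u i - l i) = (\<Sum>i\<in>?P. measure lebesgue {l i<..<u i})"
        using lu_le by (intro sum.cong) auto
      also have "\<dots> = measure lebesgue (\<Union>i\<in>?P. {l i<..<u i})"
        using finp dP by (intro measure_finite_Union[symmetric]) (auto simp: lu_le)
      also have "\<dots> \<le> measure lebesgue T"
      proof (rule measure_mono_fmeasurable[OF _ _ Tm])
        show "(\<Union>i\<in>?P. {l i<..<u i}) \<subseteq> T"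
        proof
          fix t assume "t \<in> (\<Union>i\<in>?P. {l i<..<u i})"
          then obtain i where i: "i \<in> p" "fst i \<in> S" "t \<in> {l i<..<u i}" by blast
          then have "snd i \<subseteq> T"
            using fineD[OF p(2), of "fst i" "snd i"] by (simp add: g_def)
          moreover have "t \<in> snd i" using lu(1)[OF i(1)] i(3) by simp
          ultimately show "t \<in> T" by blast
        qed
      qed (use finp in auto)
      also have "\<dots> < \<delta>" by (rule mT)
      finally show "(\<Sum>i\<in>?P. u i - l i) < \<delta>" .
    qed (use finp lu lu_le in auto)
    moreover have "(\<Sum>i\<in>p - ?P. norm (f (u i) - f (l i))) \<le> (\<Sum>i\<in>p - ?P. e * (u i - l i))"
    proof (rule sum_mono)
      fix i assume i: "i \<in> p - ?P"
      then have x: "fst i \<in> {a..b} - S" using lu[of i] by auto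
      have ball: "{l i..u i} \<subseteq> ball (fst i) (r (fst i))"
        using fineD[OF p(2), of "fst i" "snd i"] i x lu(1)[of i] by (simp add: g_def)
      have near: "\<bar>u i - fst i\<bar> < r (fst i)" "\<bar>l i - fst i\<bar> < r (fst i)"
        using subsetD[OF ball, of "u i"] subsetD[OF ball, of "l i"] lu_le[of i] i
        by (auto simp: dist_real_def)
      have "u i \<in> {a..b}" "l i \<in> {a..b}"
        using lu[of i] i x by auto
      then have "norm (f (u i) - f (fst i)) \<le> e * \<bar>u i - fst i\<bar>" "norm (f (l i) - f (fst i)) \<le> e * \<bar>l i - fst i\<bar>"
        using r[OF x] near by blast+
      \<comment> \<open>The tag lies between the endpoints, so its distances to them add up to
        exactly \<open>u i - l i\<close>.\<close>
      then show "norm (f (u i) - f (l i)) \<le> e * (u i - l i)"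
        using norm_triangle_ineq4[of "f (u i) - f (fst i)" "f (l i) - f (fst i)"] lu[of i] i
        by (simp add: algebra_simps)
    qed
    moreover have "(\<Sum>i\<in>p - ?P. e * (u i - l i)) \<le> (\<Sum>i\<in>p. e * (u i - l i))"
      using finp lu_le \<open>e > 0\<close> by (intro sum_mono2) auto
    moreover have "(\<Sum>i\<in>p. e * (u i - l i)) = e * (b - a)"
      using tele[of "\<lambda>t. t"] by (simp flip: sum_distrib_left)
    moreover have "(\<Sum>i\<in>p. norm (f (u i) - f (l i)))
        = (\<Sum>i\<in>p - ?P. norm (f (u i) - f (l i))) + (\<Sum>i\<in>?P. norm (f (u i) - f (l i)))"
      using finp by (intro sum.subset_diff) auto
    moreover have "norm (f b - f a) \<le> (\<Sum>i\<in>p. norm (f (u i) - f (l i)))"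
      using norm_sum[of "\<lambda>i. f (u i) - f (l i)" p] by (simp add: tele)
    ultimately show ?thesis by (simp add: algebra_simps)
  qed
  have "norm (f b - f a) \<le> 0 + e" if "e > 0" for e
    using bound[of "e / (1 + (b - a))"] that \<open>a \<le> b\<close> by simp
  then have "norm (f b - f a) \<le> 0" by (rule field_le_epsilon)
  then show ?thesis by simp
qed

section \<open>A first-touching argument for exponential barriers\<close>

text \<open>All members of the family are treated at once, because \<open>inward\<close> has to know
  the whole past of every member in order to control delayed terms. At a first touching time the
  squared norm grows strictly slower than the squared barrier, so it would have exceeded the barrier
  just before. The rate \<open>c\<close> may have either sign: it is 1 for the growth bound and
  \<open>- \<gamma>\<close> for the decay.\<close>

lemma exponential_barrier:
  fixes w :: "'i \<Rightarrow> real \<Rightarrow> 'a::real_inner"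
  assumes "finite I"
    and cont: "\<And>i. i \<in> I \<Longrightarrow> continuous_on {a..} (w i)"
    and start: "\<And>i. i \<in> I \<Longrightarrow> norm (w i a) < \<beta>"
    and deriv: "\<And>i t. \<lbrakk>i \<in> I; t > a\<rbrakk> \<Longrightarrow> (w i has_vector_derivative w' i t) (at t)"
    and inward: "\<And>i t. \<lbrakk>i \<in> I; t > a; norm (w i t) = \<beta> * exp (c * (t - a));
        \<And>j s. \<lbrakk>j \<in> I; a \<le> s; s \<le> t\<rbrakk> \<Longrightarrow> norm (w j s) \<le> \<beta> * exp (c * (s - a))\<rbrakk>
        \<Longrightarrow> w i t \<bullet> w' i t < c * (norm (w i t))\<^sup>2"
    and "i \<in> I" "t \<ge> a"
  shows "norm (w i t) < \<beta> * exp (c * (t - a))"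
proof (rule ccontr)
  assume neg: "\<not> ?thesis"
  \<comment> \<open>The times at which some member has reached the barrier. Being a finite union of
    closed sets, \<open>S\<close> contains its infimum, which is the first touching time.\<close>
  define S where "S = (\<Union>i\<in>I. {t \<in> {a..}. \<beta> * exp (c * (t - a)) \<le> norm (w i t)})"
  have "closed {t \<in> {a..}. \<beta> * exp (c * (t - a)) \<le> norm (w i t)}" if "i \<in> I" for i
    by (intro continuous_closed_preimage_constant continuous_on_closed_Collect_le
        continuous_intros cont that)
  then have "closed S"
    unfolding S_def using \<open>finite I\<close> by auto
  moreover have "t \<in> S" using neg \<open>i \<in> I\<close> \<open>t \<ge> a\<close> by (force simp: S_def not_less)
  moreover have bdd: "bdd_below S" by (auto simp: S_def bdd_below_def)
  ultimately have TS: "Inf S \<in> S"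
    by (intro closed_contains_Inf) auto
  define T where "T = Inf S"
  have less: "norm (w j s) < \<beta> * exp (c * (s - a))" if "j \<in> I" "a \<le> s" "s < T" for j s
    using cInf_lower[OF _ bdd, of s] that unfolding T_def S_def by force
  obtain i where i: "i \<in> I" "T \<ge> a" "\<beta> * exp (c * (T - a)) \<le> norm (w i T)"
    using TS unfolding T_def[symmetric] by (auto simp: S_def)
  have "T > a" using i start[OF i(1)] by (cases "T = a") auto
  \<comment> \<open>The strict bounds before \<open>T\<close> survive as weak ones in the limit from
    the left, which is what \<open>inward\<close> requires at \<open>T\<close> itself.\<close>
  have at_T: "norm (w j T) \<le> \<beta> * exp (c * (T - a))" if "j \<in> I" for j
  proof (rule tendsto_le[of "at_left T"])
    have "continuous (at T) (w j)"
      using deriv[OF that \<open>T > a\<close>] by (rule has_vector_derivative_continuous)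
    then show "((\<lambda>s. norm (w j s)) \<longlongrightarrow> norm (w j T)) (at_left T)"
      by (intro tendsto_norm) (auto simp: continuous_within intro: tendsto_within_subset)
    show "((\<lambda>s. \<beta> * exp (c * (s - a))) \<longlongrightarrow> \<beta> * exp (c * (T - a))) (at_left T)"
      by (intro tendsto_intros)
    show "\<forall>\<^sub>F s in at_left T. norm (w j s) \<le> \<beta> * exp (c * (s - a))"
      using eventually_at_left_real[OF \<open>T > a\<close>]
      by eventually_elim (auto intro!: less_imp_le less[OF that])
  qed simp
  have eq: "norm (w i T) = \<beta> * exp (c * (T - a))" using i at_T by force
  have in_less: "w i T \<bullet> w' i T < c * (norm (w i T))\<^sup>2"
  proof (rule inward[OF i(1) \<open>T > a\<close> eq])
    fix j s assume "j \<in> I" "a \<le> s" "s \<le> T"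
    then show "norm (w j s) \<le> \<beta> * exp (c * (s - a))"
      using less[of j s] at_T[of j] by (cases "s = T") auto
  qed
  \<comment> \<open>Squares are compared because the norm need not be differentiable at 0. Here
    \<open>f\<close> vanishes at \<open>T\<close> and is negative before \<open>T\<close>, which
    contradicts a negative derivative at \<open>T\<close>.\<close>
  define f where "f s = w i s \<bullet> w i s - (\<beta> * exp (c * (s - a)))\<^sup>2" for s
  have "((\<lambda>s. w i s \<bullet> w i s) has_real_derivative 2 * (w i T \<bullet> w' i T)) (at T)"
    unfolding has_field_derivative_def
    by (rule has_derivative_eq_rhs[OF has_derivative_inner[OF
          deriv[OF i(1) \<open>T > a\<close>, unfolded has_vector_derivative_def]
          deriv[OF i(1) \<open>T > a\<close>, unfolded has_vector_derivative_def]]])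
      (auto simp: fun_eq_iff inner_commute)
  then have "(f has_real_derivative
      2 * (w i T \<bullet> w' i T) - 2 * c * (\<beta> * exp (c * (T - a)))\<^sup>2) (at T)"
    unfolding f_def by (auto intro!: derivative_eq_intros simp: power2_eq_square)
  moreover have "2 * (w i T \<bullet> w' i T) - 2 * c * (\<beta> * exp (c * (T - a)))\<^sup>2 < 0"
    using in_less eq by simp
  ultimately obtain d where d: "d > 0" "\<And>h. \<lbrakk>0 < h; h < d\<rbrakk> \<Longrightarrow> f T < f (T - h)"
    using DERIV_neg_dec_left by blast
  \<comment> \<open>The second bound keeps \<open>T - h\<close> at or after the starting time
    \<open>a\<close>, where \<open>less\<close> is available.\<close>
  define h where "h = min (d / 2) (T - a)"
  have h: "0 < h" "h < d" "a \<le> T - h" "T - h < T" using d(1) \<open>T > a\<close> by (auto simp: h_def)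
  have "(norm (w i (T - h)))\<^sup>2 < (\<beta> * exp (c * (T - h - a)))\<^sup>2"
    using less[OF i(1) h(3,4)] by (intro power_strict_mono) auto
  then have "f (T - h) < 0" by (simp add: f_def power2_norm_eq_inner)
  moreover have "f T = 0" unfolding f_def eq[symmetric] by (simp add: power2_norm_eq_inner)
  ultimately show False using d(2)[OF h(1,2)] by simp
qed

section \<open>The leader: uniqueness and steering\<close>

text \<open>The final claim concerns every trajectory driven by the control. This lemma transfers to
  all of them what is known about the explicit one.\<close>

lemma leader_trajectory_unique:
  assumes y: "leader_trajectory r u yinit y" and z: "leader_trajectory r u yinit z"
    and "r \<ge> 0" "t \<ge> -r"
  shows "y t = z t"
proof (cases "t \<le> 0")
  case True
  then show ?thesis using assms unfolding leader_trajectory_def by auto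
next
  case False
  then have "t > 0" by simp
  have init: "y 0 = z 0"
    using y z \<open>r \<ge> 0\<close> unfolding leader_trajectory_def by auto
  have "AE s in lebesgue_on {0<..}. ((\<lambda>s. y s - z s) has_vector_derivative 0) (at s)"
  proof -
    have "AE s in lebesgue_on {0<..}. (y has_vector_derivative u s) (at s)"
      "AE s in lebesgue_on {0<..}. (z has_vector_derivative u s) (at s)"
      using y z unfolding leader_trajectory_def by auto
    then show ?thesis
    proof eventually_elim
      case (elim s)
      from has_vector_derivative_diff[OF this] show ?case by simp
    qed
  qed
  then have "AE s in lebesgue. s \<in> {0<..} \<longrightarrow> ((\<lambda>s. y s - z s) has_vector_derivative 0) (at s)"
    by (subst (asm) AE_restrict_space_iff) auto
  then obtain S where S: "negligible S"
      "\<And>s. \<lbrakk>s > 0; s \<notin> S\<rbrakk> \<Longrightarrow> ((\<lambda>s. y s - z s) has_vector_derivative 0) (at s)"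
    unfolding eventually_ae_filter_negligible by auto
  have "abs_continuous_on 0 t (\<lambda>s. y s - z s)"
    using y z \<open>t > 0\<close> unfolding leader_trajectory_def by (intro abs_continuous_on_diff) auto
  then have "y t - z t = y 0 - z 0"
  proof (rule abs_continuous_on_zero_derivative[rotated])
    \<comment> \<open>The differential equation is given for positive times only, so the left
      endpoint joins the exceptional set.\<close>
    show "negligible (insert 0 S)" using S(1) by simp
    show "((\<lambda>s. y s - z s) has_vector_derivative 0) (at s within {0..t})"
      if "s \<in> {0..t} - insert 0 S" for s
      using S(2)[of s] that by (auto intro: has_vector_derivative_at_within)
  qed (use \<open>t > 0\<close> in simp)
  then show ?thesis using init by simp
qed

text \<open>Boundedness of the whole trajectory, including its history, is recorded because the
  later bound on the followers needs it.\<close>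

lemma steering_control_exists:
  fixes yinit :: "real \<Rightarrow> real ^ 'd" and xbar :: "real ^ 'd"
  assumes "M > 0" "r \<ge> 0" and yinit: "continuous_on {-r..0} yinit"
  obtains u z T where "admissible M u" "leader_trajectory r u yinit z" "T \<ge> 0"
    "\<And>t. t \<ge> T \<Longrightarrow> z t = xbar" "bounded (z ` {-r..})"
proof -
  define T where "T = norm (xbar - yinit 0) / M"
  \<comment> \<open>The velocity has norm \<open>M\<close>, unless the leader starts at
    \<open>xbar\<close>; then \<open>T = 0\<close> and \<open>v = 0\<close>.\<close>
  define v where "v = (1 / T) *\<^sub>R (xbar - yinit 0)"
  define u where "u t = (if t \<in> {0..<T} then v else 0)" for t
  \<comment> \<open>Clamping time at \<open>T\<close> makes the path Lipschitz on the whole line,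
    which provides both continuity and absolute continuity. The function \<open>z\<close> glues it
    to the prescribed history.\<close>
  define g where "g t = yinit 0 + min t T *\<^sub>R v" for t
  define z where "z t = (if t \<le> 0 then yinit t else g t)" for t
  have "T \<ge> 0" using \<open>M > 0\<close> by (simp add: T_def)
  have Tv: "T *\<^sub>R v = xbar - yinit 0" using \<open>M > 0\<close> by (simp add: v_def T_def)
  have "norm v \<le> M" using \<open>M > 0\<close> by (simp add: v_def T_def)
  have "u \<in> borel_measurable (lebesgue_on {0..})"
    unfolding u_def by (intro measurable_restrict_space1 measurable_completion) measurable
  then have "admissible M u"
    using \<open>norm v \<le> M\<close> \<open>M > 0\<close> by (auto simp: admissible_def u_def)
  have z_g: "z t = g t" if "t \<ge> 0" for t
    using that \<open>T \<ge> 0\<close> by (auto simp: z_def g_def)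
  have lip: "(norm v)-lipschitz_on X g" for X
  proof (rule lipschitz_onI)
    fix s t
    have "dist (g s) (g t) = \<bar>min s T - min t T\<bar> * norm v"
      by (simp add: g_def dist_norm flip: scaleR_diff_left)
    also have "\<dots> \<le> \<bar>s - t\<bar> * norm v"
      by (intro mult_right_mono) auto
    finally show "dist (g s) (g t) \<le> norm v * dist s t"
      by (simp add: dist_real_def mult.commute)
  qed simp
  have z_cont: "continuous_on {-r..} z"
  proof -
    have "continuous_on ({-r..0} \<union> {0..}) z"
    proof (rule continuous_on_closed_Un)
      show "continuous_on {-r..0} z"
        using yinit by (rule continuous_on_eq) (simp add: z_def)
      show "continuous_on {0..} z"
        using lipschitz_on_continuous_on[OF lip] by (rule continuous_on_eq) (simp add: z_g)
    qed auto
    moreover have "{-r..0} \<union> {0..} = {-r..}" using \<open>r \<ge> 0\<close> by auto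
    ultimately show ?thesis by simp
  qed
  have "abs_continuous_on 0 s z" for s
    by (rule lipschitz_on_imp_abs_continuous_on[OF lipschitz_on_transform[OF lip]]) (simp add: z_g)
  moreover have z_deriv: "(z has_vector_derivative u t) (at t)" if "t > 0" "t \<noteq> T" for t
  proof -
    have "(g has_vector_derivative u t) (at t)"
    proof (cases "t < T")
      case True
      have "((\<lambda>t. yinit 0 + t *\<^sub>R v) has_vector_derivative v) (at t)"
        by (auto intro!: derivative_eq_intros)
      then have "(g has_vector_derivative v) (at t)"
        by (rule has_vector_derivative_transform_within_open[of _ _ _ "{..<T}"])
          (use True in \<open>auto simp: g_def\<close>)
      then show ?thesis using True that by (simp add: u_def)
    next
      case False
      have "((\<lambda>t. yinit 0 + T *\<^sub>R v) has_vector_derivative 0) (at t)"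
        by (auto intro!: derivative_eq_intros)
      then have "(g has_vector_derivative 0) (at t)"
        by (rule has_vector_derivative_transform_within_open[of _ _ _ "{T<..}"])
          (use False that in \<open>auto simp: g_def\<close>)
      then show ?thesis using False by (simp add: u_def)
    qed
    then show ?thesis
      by (rule has_vector_derivative_transform_within_open[of _ _ _ "{0<..}"])
        (use that in \<open>auto simp: z_g\<close>)
  qed
  \<comment> \<open>The path may have a kink at the arrival time, so \<open>T\<close> is the single
    exceptional point.\<close>
  have "AE t in lebesgue. t \<in> {0<..} \<longrightarrow> (z has_vector_derivative u t) (at t)"
    unfolding eventually_ae_filter_negligible
    by (rule exI[of _ "{T}"]) (use z_deriv in auto)
  then have "AE t in lebesgue_on {0<..}. (z has_vector_derivative u t) (at t)"
    by (subst AE_restrict_space_iff) auto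
  ultimately have "leader_trajectory r u yinit z"
    using z_cont by (simp add: leader_trajectory_def z_def)
  moreover have z_T: "z t = xbar" if "t \<ge> T" for t
    using that Tv \<open>T \<ge> 0\<close> by (simp add: z_g g_def min_def)
  moreover have "bounded (z ` {-r..})"
  proof (rule bounded_subset)
    have "compact (z ` {-r..T})"
      by (intro compact_continuous_image continuous_on_subset[OF z_cont]) auto
    then show "bounded (insert xbar (z ` {-r..T}))"
      by (simp add: compact_imp_bounded)
    show "z ` {-r..} \<subseteq> insert xbar (z ` {-r..T})"
    proof
      fix w assume "w \<in> z ` {-r..}"
      then obtain t where "t \<ge> -r" "w = z t" by auto
      then show "w \<in> insert xbar (z ` {-r..T})"
        using z_T[of t] by (cases "t \<le> T") auto
    qed
  qed
  ultimately show thesis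
    using that \<open>admissible M u\<close> \<open>T \<ge> 0\<close> by blast
qed

section \<open>The followers: growth and decay estimates\<close>

text \<open>By Cauchy-Schwarz, attraction towards \<open>v\<close> pushes \<open>w\<close> outwards
  at relative rate at most \<open>k * (q - 1)\<close>. An attracting point no farther out than
  \<open>w\<close> (\<open>q = 1\<close>) never pushes outwards, while under a decaying barrier a
  delayed opinion may be farther out by the factor \<open>q = exp (\<gamma> * r)\<close>.\<close>

lemma inner_attraction_le:
  fixes w v :: "'a::real_inner"
  assumes "k \<ge> 0" "norm v \<le> q * norm w"
  shows "w \<bullet> (k *\<^sub>R (v - w)) \<le> k * ((q - 1) * (norm w)\<^sup>2)"
proof -
  have "w \<bullet> v \<le> norm w * norm v" by (rule norm_cauchy_schwarz)
  also have "\<dots> \<le> q * (norm w)\<^sup>2"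
    using mult_left_mono[OF assms(2), of "norm w"] by (simp add: power2_eq_square ac_simps)
  finally have "w \<bullet> (v - w) \<le> (q - 1) * (norm w)\<^sup>2"
    by (simp add: inner_diff_right power2_norm_eq_inner algebra_simps)
  then show ?thesis using \<open>k \<ge> 0\<close> by (simp add: mult_left_mono)
qed

lemma follower_trajectoriesD:
  assumes "follower_trajectories N r \<tau> \<tau>0 chi \<psi> \<phi> xinit y x" "i \<in> {1..N}"
  shows "continuous_on {-r..} (x i)"
    and "\<lbrakk>-r \<le> t; t \<le> 0\<rbrakk> \<Longrightarrow> x i t = xinit i t"
    and "t > 0 \<Longrightarrow> (x i has_vector_derivative
            ((1 / real N) *\<^sub>R (\<Sum>j\<in>{1..N} - {i}.
                (chi i j * \<psi> i j (x i t, x j (t - \<tau> i j))) *\<^sub>R (x j (t - \<tau> i j) - x i t))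
             + (\<phi> i (x i t, y t) / real N) *\<^sub>R (y (t - \<tau>0 i) - x i t))) (at t)"
  using assms unfolding follower_trajectories_def by auto

text \<open>Since the barrier \<open>R * exp t\<close> increases, at a touching time all delayed
  opinions are at most as far out as the touching follower, so every attraction term is harmless.
  The bound depends on the solution only through \<open>R\<close>, which is the source of uniform
  constants.\<close>

lemma follower_growth:
  fixes x :: "nat \<Rightarrow> real \<Rightarrow> real ^ 'd"
  assumes traj: "follower_trajectories N r \<tau> \<tau>0 chi \<psi> \<phi> xinit y x"
    and "r \<ge> 0"
    and tau: "\<And>i j. \<lbrakk>i \<in> {1..N}; j \<in> {1..N}\<rbrakk> \<Longrightarrow> 0 \<le> \<tau> i j \<and> \<tau> i j \<le> r"
    and tau0: "\<And>i. i \<in> {1..N} \<Longrightarrow> 0 \<le> \<tau>0 i \<and> \<tau>0 i \<le> r"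
    and weight: "\<And>i j z. \<lbrakk>i \<in> {1..N}; j \<in> {1..N}\<rbrakk> \<Longrightarrow> 0 \<le> chi i j * \<psi> i j z"
    and phi: "\<And>i z. i \<in> {1..N} \<Longrightarrow> 0 \<le> \<phi> i z"
    and xinit: "\<And>i t. \<lbrakk>i \<in> {1..N}; -r \<le> t; t \<le> 0\<rbrakk> \<Longrightarrow> norm (xinit i t) < R"
    and y: "\<And>t. -r \<le> t \<Longrightarrow> norm (y t) < R"
    and "i \<in> {1..N}" "t \<ge> 0"
  shows "norm (x i t) < R * exp t"
proof -
  have "R > 0" using y[of 0] \<open>r \<ge> 0\<close> le_less_trans[OF norm_ge_zero] by fastforce
  note D = follower_trajectoriesD[OF traj]
  have "norm (x i t) < R * exp (1 * (t - 0))"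
  proof (rule exponential_barrier[where I = "{1..N}" and w = x])
    fix i assume i: "i \<in> {1..N}"
    show "continuous_on {0..} (x i)"
      using D(1)[OF i] by (rule continuous_on_subset) (use \<open>r \<ge> 0\<close> in auto)
    show "norm (x i 0) < R"
      using D(2)[OF i, of 0] xinit[OF i, of 0] \<open>r \<ge> 0\<close> by simp
    fix t :: real assume "t > 0"
    then show "(x i has_vector_derivative
            ((1 / real N) *\<^sub>R (\<Sum>j\<in>{1..N} - {i}.
                (chi i j * \<psi> i j (x i t, x j (t - \<tau> i j))) *\<^sub>R (x j (t - \<tau> i j) - x i t))
             + (\<phi> i (x i t, y t) / real N) *\<^sub>R (y (t - \<tau>0 i) - x i t))) (at t)"
      by (rule D(3)[OF i])
    assume eq: "norm (x i t) = R * exp (1 * (t - 0))"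
      and below: "\<And>j s. \<lbrakk>j \<in> {1..N}; 0 \<le> s; s \<le> t\<rbrakk> \<Longrightarrow> norm (x j s) \<le> R * exp (1 * (s - 0))"
    have R_le: "R \<le> 1 * norm (x i t)" using eq \<open>R > 0\<close> \<open>t > 0\<close> by simp
    \<comment> \<open>The delayed time lies either in the solution interval, where the barrier is
      lower than at \<open>t\<close>, or in the initial history, which is bounded by
      \<open>R\<close>.\<close>
    have past: "norm (x j (t - s)) \<le> 1 * norm (x i t)" if "j \<in> {1..N}" "0 \<le> s" "s \<le> r" for j s
    proof (cases "s \<le> t")
      case True
      have "R * exp (t - s) \<le> R * exp t" using \<open>R > 0\<close> that by simp
      then show ?thesis using below[of j "t - s"] that True eq by simp
    next
      case False
      then show ?thesis using D(2)[of j "t - s"] xinit[of j "t - s"] that R_le \<open>t > 0\<close> by simp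
    qed
    have "x i t \<bullet> ((chi i j * \<psi> i j (x i t, x j (t - \<tau> i j))) *\<^sub>R (x j (t - \<tau> i j) - x i t)) \<le> 0"
      if "j \<in> {1..N} - {i}" for j
      using inner_attraction_le[OF weight past] tau[OF i] i that by fastforce
    then have followers: "(\<Sum>j\<in>{1..N} - {i}. x i t \<bullet>
        ((chi i j * \<psi> i j (x i t, x j (t - \<tau> i j))) *\<^sub>R (x j (t - \<tau> i j) - x i t))) \<le> 0"
      by (rule sum_nonpos)
    have "norm (y (t - \<tau>0 i)) \<le> 1 * norm (x i t)"
      using y[of "t - \<tau>0 i"] tau0[OF i] R_le \<open>t > 0\<close> by simp
    from inner_attraction_le[OF _ this, of "\<phi> i (x i t, y t) / real N"]
    have leader: "x i t \<bullet> ((\<phi> i (x i t, y t) / real N) *\<^sub>R (y (t - \<tau>0 i) - x i t)) \<le> 0"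
      using phi[OF i] by simp
    have "x i t \<noteq> 0" using eq \<open>R > 0\<close> by auto
    \<comment> \<open>The attraction terms give only a weak inequality; the strictness comes from
      the positive growth rate 1 of the barrier.\<close>
    then have "0 < 1 * (norm (x i t))\<^sup>2" by simp
    moreover have "(1 / real N) * (\<Sum>j\<in>{1..N} - {i}. x i t \<bullet>
        ((chi i j * \<psi> i j (x i t, x j (t - \<tau> i j))) *\<^sub>R (x j (t - \<tau> i j) - x i t))) \<le> 0"
      using followers by (intro mult_nonneg_nonpos) auto
    ultimately show "x i t \<bullet> ((1 / real N) *\<^sub>R (\<Sum>j\<in>{1..N} - {i}.
                (chi i j * \<psi> i j (x i t, x j (t - \<tau> i j))) *\<^sub>R (x j (t - \<tau> i j) - x i t))
             + (\<phi> i (x i t, y t) / real N) *\<^sub>R (y (t - \<tau>0 i) - x i t)) < 1 * (norm (x i t))\<^sup>2"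
      using leader unfolding inner_add_right inner_scaleR_right[of _ "1 / real N"] inner_sum_right
      by linarith
  qed (use assms in auto)
  then show ?thesis by simp
qed

text \<open>Waiting for one maximal delay after \<open>t0\<close> ensures that the delayed leader
  opinion is \<open>xbar\<close> too. The interval from \<open>t0\<close> to \<open>t1\<close> then
  serves as the initial history for the barrier started at \<open>t1\<close>.\<close>

lemma follower_decay:
  fixes x :: "nat \<Rightarrow> real \<Rightarrow> real ^ 'd"
  assumes traj: "follower_trajectories N r \<tau> \<tau>0 chi \<psi> \<phi> xinit y x"
    and "r \<ge> 0" "t0 \<ge> 0" "t1 = t0 + r"
    and tau: "\<And>i j. \<lbrakk>i \<in> {1..N}; j \<in> {1..N}\<rbrakk> \<Longrightarrow> 0 \<le> \<tau> i j \<and> \<tau> i j \<le> r"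
    and tau0: "\<And>i. i \<in> {1..N} \<Longrightarrow> 0 \<le> \<tau>0 i \<and> \<tau>0 i \<le> r"
    and weight: "\<And>i j z. \<lbrakk>i \<in> {1..N}; j \<in> {1..N}\<rbrakk> \<Longrightarrow> 0 \<le> chi i j * \<psi> i j z \<and> chi i j * \<psi> i j z \<le> K"
    and phi: "\<And>i z. \<lbrakk>i \<in> {1..N}; norm (z - xbar) \<le> D\<rbrakk> \<Longrightarrow> m \<le> \<phi> i (z, xbar)"
    and y: "\<And>t. t0 \<le> t \<Longrightarrow> y t = xbar"
    and start: "\<And>i t. \<lbrakk>i \<in> {1..N}; t0 \<le> t; t \<le> t1\<rbrakk> \<Longrightarrow> norm (x i t - xbar) < D"
    and rate: "\<gamma> \<ge> 0" "K * (exp (\<gamma> * r) - 1) - m / real N < - \<gamma>"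
    and "i \<in> {1..N}" "t \<ge> t1"
  shows "norm (x i t - xbar) < D * exp (- \<gamma> * (t - t1))"
proof (rule exponential_barrier[where I = "{1..N}" and w = "\<lambda>i t. x i t - xbar"])
  note D = follower_trajectoriesD[OF traj]
  have "D > 0" using start[OF \<open>i \<in> {1..N}\<close>, of t0] \<open>r \<ge> 0\<close> \<open>t1 = _\<close> le_less_trans[OF norm_ge_zero] by fastforce
  have t1: "t1 \<ge> 0" "t0 \<le> t1" using assms(2-4) by auto
  fix i assume i: "i \<in> {1..N}"
  then have "N > 0" by auto
  show "continuous_on {t1..} (\<lambda>t. x i t - xbar)"
    using D(1)[OF i] \<open>r \<ge> 0\<close> t1
    by (intro continuous_intros) (auto elim: continuous_on_subset)
  show "norm (x i t1 - xbar) < D"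
    using start[OF i, of t1] t1 by simp
  fix t :: real assume "t > t1"
  then have "t > 0" using t1 by simp
  show "((\<lambda>t. x i t - xbar) has_vector_derivative
            ((1 / real N) *\<^sub>R (\<Sum>j\<in>{1..N} - {i}.
                (chi i j * \<psi> i j (x i t, x j (t - \<tau> i j))) *\<^sub>R (x j (t - \<tau> i j) - x i t))
             + (\<phi> i (x i t, y t) / real N) *\<^sub>R (y (t - \<tau>0 i) - x i t))) (at t)"
    using has_vector_derivative_diff[OF D(3)[OF i \<open>t > 0\<close>] has_vector_derivative_const[of xbar]]
    by simp
  assume eq: "norm (x i t - xbar) = D * exp (- \<gamma> * (t - t1))"
    and below: "\<And>j s. \<lbrakk>j \<in> {1..N}; t1 \<le> s; s \<le> t\<rbrakk> \<Longrightarrow> norm (x j s - xbar) \<le> D * exp (- \<gamma> * (s - t1))"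
  let ?w = "x i t - xbar" and ?q = "exp (\<gamma> * r)"
  \<comment> \<open>Going back by a delay of at most \<open>r\<close> raises the decaying barrier by
    a factor of at most \<open>exp (\<gamma> * r)\<close>.\<close>
  have past: "norm (x j (t - s) - xbar) \<le> ?q * norm ?w" if s: "j \<in> {1..N}" "0 \<le> s" "s \<le> r" for j s
  proof -
    have "norm (x j (t - s) - xbar) \<le> D * exp (- \<gamma> * (t - s - t1))"
    proof (cases "t1 \<le> t - s")
      case True
      then show ?thesis using below[of j "t - s"] s by simp
    next
      case False
      \<comment> \<open>Before \<open>t1\<close> the extrapolated barrier lies above
        \<open>D\<close>, so \<open>start\<close> suffices.\<close>
      have "D * 1 \<le> D * exp (- \<gamma> * (t - s - t1))"
        using \<open>D > 0\<close> rate(1) False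
        by (intro mult_left_mono) (auto simp: mult_nonneg_nonpos)
      then show ?thesis
        using start[of j "t - s"] s False \<open>t > t1\<close> \<open>t1 = _\<close> by simp
    qed
    also have "\<dots> \<le> D * exp (\<gamma> * r + - \<gamma> * (t - t1))"
      using \<open>D > 0\<close> rate(1) s mult_left_mono[of s r \<gamma>] by (simp add: algebra_simps)
    also have "\<dots> = ?q * norm ?w"
      unfolding eq exp_add by simp
    finally show ?thesis .
  qed
  \<comment> \<open>Any argument of the weight would do.\<close>
  have "K \<ge> 0" using weight[OF i i, of undefined] by simp
  have "?q \<ge> 1" using \<open>r \<ge> 0\<close> rate(1) by simp
  have "?w \<bullet> ((chi i j * \<psi> i j (x i t, x j (t - \<tau> i j))) *\<^sub>R (x j (t - \<tau> i j) - x i t))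
      \<le> K * ((?q - 1) * (norm ?w)\<^sup>2)" if j: "j \<in> {1..N} - {i}" for j
  proof -
    let ?k = "chi i j * \<psi> i j (x i t, x j (t - \<tau> i j))"
    have k: "0 \<le> ?k" "?k \<le> K" using weight[OF i, of j] j by auto
    have "norm (x j (t - \<tau> i j) - xbar) \<le> ?q * norm ?w"
      using past[of j] tau[OF i, of j] j by simp
    from inner_attraction_le[OF k(1) this]
    have "?w \<bullet> (?k *\<^sub>R (x j (t - \<tau> i j) - x i t)) \<le> ?k * ((?q - 1) * (norm ?w)\<^sup>2)" by simp
    also have "\<dots> \<le> K * ((?q - 1) * (norm ?w)\<^sup>2)"
      using k(2) \<open>?q \<ge> 1\<close> by (intro mult_right_mono) auto
    finally show ?thesis .
  qed
  then have "(\<Sum>j\<in>{1..N} - {i}. ?w \<bullet>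
      ((chi i j * \<psi> i j (x i t, x j (t - \<tau> i j))) *\<^sub>R (x j (t - \<tau> i j) - x i t)))
      \<le> real (card ({1..N} - {i})) * (K * ((?q - 1) * (norm ?w)\<^sup>2))"
    by (rule sum_bounded_above)
  \<comment> \<open>Counting \<open>N\<close> neighbours instead of \<open>N - 1\<close> cancels the
    factor \<open>1 / real N\<close>.\<close>
  also have "\<dots> \<le> real N * (K * ((?q - 1) * (norm ?w)\<^sup>2))"
    using i \<open>K \<ge> 0\<close> \<open>?q \<ge> 1\<close> by (intro mult_right_mono) auto
  finally have followers: "(1 / real N) * (\<Sum>j\<in>{1..N} - {i}. ?w \<bullet>
      ((chi i j * \<psi> i j (x i t, x j (t - \<tau> i j))) *\<^sub>R (x j (t - \<tau> i j) - x i t)))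
      \<le> K * ((?q - 1) * (norm ?w)\<^sup>2)"
    using \<open>N > 0\<close> by (simp add: pos_divide_le_eq mult.commute)
  have y_eq: "y t = xbar" "y (t - \<tau>0 i) = xbar"
    using y \<open>t > t1\<close> tau0[OF i] \<open>t1 = _\<close> \<open>r \<ge> 0\<close> by auto
  \<comment> \<open>The touching follower is still in the ball on which \<open>m\<close> bounds the
    leader weights from below.\<close>
  have "norm ?w \<le> D"
    unfolding eq using \<open>D > 0\<close> rate(1) \<open>t > t1\<close> by (simp add: mult_le_cancel_left1)
  then have "m / real N \<le> \<phi> i (x i t, y t) / real N"
    using phi[OF i] y_eq by (simp add: divide_right_mono)
  then have "m / real N * (norm ?w)\<^sup>2 \<le> \<phi> i (x i t, y t) / real N * (norm ?w)\<^sup>2"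
    by (rule mult_right_mono) simp
  moreover have minus_w: "xbar - x i t = - ?w" by simp
  have "?w \<bullet> ((\<phi> i (x i t, y t) / real N) *\<^sub>R (y (t - \<tau>0 i) - x i t))
      = - (\<phi> i (x i t, y t) / real N * (norm ?w)\<^sup>2)"
    unfolding y_eq(2) inner_scaleR_right
    by (subst minus_w) (simp only: inner_minus_right power2_norm_eq_inner mult_minus_right)
  ultimately have leader: "?w \<bullet> ((\<phi> i (x i t, y t) / real N) *\<^sub>R (y (t - \<tau>0 i) - x i t))
      \<le> - (m / real N) * (norm ?w)\<^sup>2"
    by simp
  have "?w \<noteq> 0" using eq \<open>D > 0\<close> by force
  then have "(K * (?q - 1) - m / real N) * (norm ?w)\<^sup>2 < - \<gamma> * (norm ?w)\<^sup>2"
    using rate(2) by (intro mult_strict_right_mono) auto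
  then show "?w \<bullet> ((1 / real N) *\<^sub>R (\<Sum>j\<in>{1..N} - {i}.
                (chi i j * \<psi> i j (x i t, x j (t - \<tau> i j))) *\<^sub>R (x j (t - \<tau> i j) - x i t))
             + (\<phi> i (x i t, y t) / real N) *\<^sub>R (y (t - \<tau>0 i) - x i t)) < - \<gamma> * (norm ?w)\<^sup>2"
    using leader followers unfolding inner_add_right inner_scaleR_right[of _ "1 / real N"] inner_sum_right
    by (simp add: left_diff_distrib mult.assoc)
qed (use assms in auto)

section \<open>Choice of the constants and conclusion\<close>

text \<open>At \<open>\<gamma> = 0\<close> the difference of the two sides is
  \<open>- \<mu> < 0\<close>; by continuity it stays negative for small positive
  \<open>\<gamma>\<close>.\<close>

lemma decay_rate_exists:
  fixes K r \<mu> :: real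
  assumes "\<mu> > 0"
  obtains \<gamma> where "\<gamma> > 0" "K * (exp (\<gamma> * r) - 1) - \<mu> < - \<gamma>"
proof -
  have "((\<lambda>\<gamma>. K * (exp (\<gamma> * r) - 1) - \<mu> + \<gamma>) \<longlongrightarrow> K * (exp (0 * r) - 1) - \<mu> + 0) (at_right 0)"
    by (intro tendsto_intros)
  then have "\<forall>\<^sub>F \<gamma> in at_right 0. K * (exp (\<gamma> * r) - 1) - \<mu> + \<gamma> < 0"
    by (rule order_tendstoD) (use assms in simp)
  then have "\<forall>\<^sub>F \<gamma> in at_right 0. \<gamma> > 0 \<and> K * (exp (\<gamma> * r) - 1) - \<mu> + \<gamma> < 0"
    using eventually_at_right_less by eventually_elim simp
  from eventually_happens'[OF trivial_limit_at_right_real this] show thesis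
    using that by force
qed

lemma opinion_diameter_le:
  fixes y :: "real \<Rightarrow> real ^ 'd"
  assumes "N > 0" and "\<And>i. i \<in> {1..N} \<Longrightarrow> norm (x i t - y t) \<le> c / 2"
  shows "opinion_diameter N y x t \<le> c"
proof -
  have "c \<ge> 0" using order_trans[OF norm_ge_zero assms(2)[of 1]] \<open>N > 0\<close> by simp
  have "norm (x i t - x j t) \<le> c" if "i \<in> {1..N}" "j \<in> {1..N}" for i j
    using norm_triangle_ineq4[of "x i t - y t" "x j t - y t"] assms(2)[OF that(1)] assms(2)[OF that(2)]
    by simp
  moreover have "norm (x i t - y t) \<le> c" if "i \<in> {1..N}" for i
    using assms(2)[OF that] \<open>c \<ge> 0\<close> by simp
  ultimately show ?thesis
    unfolding opinion_diameter_def using \<open>N > 0\<close> by (subst max.bounded_iff) (auto simp: Max_le_iff)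
qed

theorem theorem4p12:
  fixes N :: nat
    and \<tau> :: "nat \<Rightarrow> nat \<Rightarrow> real" and \<tau>0 :: "nat \<Rightarrow> real"
    and chi :: "nat \<Rightarrow> nat \<Rightarrow> real"
    and \<psi> :: "nat \<Rightarrow> nat \<Rightarrow> (real ^ 'd) \<times> (real ^ 'd) \<Rightarrow> real"
    and \<phi> :: "nat \<Rightarrow> (real ^ 'd) \<times> (real ^ 'd) \<Rightarrow> real"
    and xinit :: "nat \<Rightarrow> real \<Rightarrow> real ^ 'd" and yinit :: "real \<Rightarrow> real ^ 'd"
    and M r :: real and xbar :: "real ^ 'd"
  assumes N: "N \<ge> 3"
    and tau_pos: "\<forall>i\<in>{1..N}. \<forall>j\<in>{1..N}. \<tau> i j > 0"
    and tau0_pos: "\<forall>i\<in>{1..N}. \<tau>0 i > 0"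
    and r_def: "r = max_delay N \<tau> \<tau>0"
    and chi01: "\<forall>i\<in>{1..N}. \<forall>j\<in>{1..N}. chi i j \<in> {0, 1}"
    and psi: "\<forall>i\<in>{1..N}. \<forall>j\<in>{1..N}.
      continuous_on UNIV (\<psi> i j) \<and> (\<forall>z. \<psi> i j z > 0) \<and> bounded (range (\<psi> i j))"
    and phi: "\<forall>i\<in>{1..N}.
      continuous_on UNIV (\<phi> i) \<and> (\<forall>z. \<phi> i z > 0) \<and> bounded (range (\<phi> i))"
    and xinit: "\<forall>i\<in>{1..N}. continuous_on {-r..0} (xinit i)"
    and yinit: "continuous_on {-r..0} yinit"
    and M: "M > 0"
  shows "\<exists>u. admissible M u \<and>
    (\<exists>y. leader_trajectory r u yinit y) \<and>
    (\<exists>t0>0.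
       (\<forall>y. leader_trajectory r u yinit y \<longrightarrow> (\<forall>t\<ge>t0. y t = xbar)) \<and>
       (\<exists>\<gamma>>0. \<exists>C>0. \<forall>y x.
          leader_trajectory r u yinit y \<and> follower_trajectories N r \<tau> \<tau>0 chi \<psi> \<phi> xinit y x \<longrightarrow>
          (\<forall>t\<ge>t0. opinion_diameter N y x t \<le> C * exp (- \<gamma> * t))))"
proof -
  have "N > 0" using N by simp
  have tau: "0 \<le> \<tau> i j \<and> \<tau> i j \<le> r" if "i \<in> {1..N}" "j \<in> {1..N}" for i j
  proof -
    have "\<tau> i j \<le> Max ((\<lambda>(i, j). \<tau> i j) ` ({1..N} \<times> {1..N}))"
      using that by (intro Max_ge) auto
    then have "\<tau> i j \<le> r" unfolding r_def max_delay_def by (rule max.coboundedI1)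
    then show ?thesis using tau_pos that by (simp add: less_imp_le)
  qed
  have tau0: "0 \<le> \<tau>0 i \<and> \<tau>0 i \<le> r" if "i \<in> {1..N}" for i
  proof -
    have "\<tau>0 i \<le> Max (\<tau>0 ` {1..N})"
      using that by (intro Max_ge) auto
    then have "\<tau>0 i \<le> r" unfolding r_def max_delay_def by (rule max.coboundedI2)
    then show ?thesis using tau0_pos that by (simp add: less_imp_le)
  qed
  have "r \<ge> 0" using tau0[of 1] \<open>N > 0\<close> by simp
  obtain u z T where u: "admissible M u" and z: "leader_trajectory r u yinit z"
    and T: "T \<ge> 0" "\<And>t. t \<ge> T \<Longrightarrow> z t = xbar" and z_bdd: "bounded (z ` {-r..})"
    using steering_control_exists[OF M \<open>r \<ge> 0\<close> yinit] by metis
  \<comment> \<open>The travel time \<open>T\<close> vanishes if the leader starts at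
    \<open>xbar\<close>, but \<open>t0\<close> has to be positive.\<close>
  define t0 where "t0 = T + 1"
  define t1 where "t1 = t0 + r"
  have t0: "t0 > 0" "t1 \<ge> 0" using T(1) \<open>r \<ge> 0\<close> by (auto simp: t0_def t1_def)
  have unique: "y t = z t" if "leader_trajectory r u yinit y" "t \<ge> -r" for y t
    using leader_trajectory_unique[OF that(1) z \<open>r \<ge> 0\<close> that(2)] .
  have at_rest: "y t = xbar" if "leader_trajectory r u yinit y" "t \<ge> t0" for y t
    using unique[OF that(1), of t] T(2)[of t] that(2) t0 \<open>r \<ge> 0\<close> by (simp add: t0_def)

  have "bounded (z ` {-r..} \<union> (\<Union>i\<in>{1..N}. xinit i ` {-r..0}))"
    using z_bdd xinit by (auto intro!: compact_imp_bounded compact_continuous_image)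
  \<comment> \<open>\<open>R\<close> depends only on the initial data and on the explicit leader
    path, so all constants below are fixed before any follower solution is chosen.\<close>
  then obtain R where R: "R > 0"
    "\<And>w. w \<in> z ` {-r..} \<union> (\<Union>i\<in>{1..N}. xinit i ` {-r..0}) \<Longrightarrow> norm w < R"
    unfolding bounded_pos_less by blast
  \<comment> \<open>The growth bound at time \<open>t1\<close>, converted from distance to the
    origin into distance to \<open>xbar\<close>.\<close>
  define D where "D = R * exp t1 + norm xbar"
  have "D > 0" using R(1) by (simp add: D_def add_pos_nonneg)
  have "bounded (\<Union>i\<in>{1..N}. \<Union>j\<in>{1..N}. range (\<psi> i j))"
    using psi by auto
  then obtain K where K: "K > 0"
    "\<And>w. w \<in> (\<Union>i\<in>{1..N}. \<Union>j\<in>{1..N}. range (\<psi> i j)) \<Longrightarrow> norm w < K"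
    unfolding bounded_pos_less by blast
  have weight: "0 \<le> chi i j * \<psi> i j w \<and> chi i j * \<psi> i j w \<le> K"
    if ij: "i \<in> {1..N}" "j \<in> {1..N}" for i j w
  proof -
    have "chi i j = 0 \<or> chi i j = 1" using chi01 ij by auto
    moreover have "\<psi> i j w > 0" using psi ij by blast
    moreover have "norm (\<psi> i j w) < K" using K(2) ij by blast
    ultimately show ?thesis using K(1) by auto
  qed
  \<comment> \<open>A positive continuous weight may tend to 0 at infinity; compactness of the ball
    gives a positive minimum there.\<close>
  have "\<exists>m>0. \<forall>w\<in>cball xbar D. m \<le> \<phi> i (w, xbar)" if i: "i \<in> {1..N}" for i
  proof -
    have "continuous_on UNIV (\<phi> i)" using phi i by blast
    then have "continuous_on (cball xbar D) (\<lambda>w. \<phi> i (w, xbar))"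
      by (rule continuous_on_compose2) (auto intro!: continuous_intros)
    moreover have "cball xbar D \<noteq> {}" using \<open>D > 0\<close> by simp
    ultimately obtain w0 where w0: "\<forall>w\<in>cball xbar D. \<phi> i (w0, xbar) \<le> \<phi> i (w, xbar)"
      using continuous_attains_inf[OF compact_cball, of xbar D "\<lambda>w. \<phi> i (w, xbar)"] by blast
    have "\<phi> i (w0, xbar) > 0" using phi i by blast
    with w0 show ?thesis by blast
  qed
  then obtain m where m: "\<And>i. i \<in> {1..N} \<Longrightarrow> m i > 0 \<and> (\<forall>w\<in>cball xbar D. m i \<le> \<phi> i (w, xbar))"
    by metis
  define \<mu> where "\<mu> = Min (m ` {1..N})"
  have "\<mu> > 0" using m \<open>N > 0\<close> by (simp add: \<mu>_def Min_gr_iff)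
  have phi_ge: "\<mu> \<le> \<phi> i (w, xbar)" if "i \<in> {1..N}" "norm (w - xbar) \<le> D" for i w
  proof -
    have "\<mu> \<le> m i" unfolding \<mu>_def using that by (intro Min_le) auto
    also have "m i \<le> \<phi> i (w, xbar)"
      using m[OF that(1)] that(2) by (simp add: dist_norm norm_minus_commute)
    finally show ?thesis .
  qed
  obtain \<gamma> where \<gamma>: "\<gamma> > 0" "K * (exp (\<gamma> * r) - 1) - \<mu> / real N < - \<gamma>"
    using decay_rate_exists[of "\<mu> / real N" K r] \<open>\<mu> > 0\<close> \<open>N > 0\<close> by auto
  \<comment> \<open>The factor 2 pays for the triangle inequality in
    \<open>opinion_diameter_le\<close>, and \<open>exp (\<gamma> * t1)\<close> moves the origin of
    the decay from \<open>t1\<close> to 0.\<close>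
  define C where "C = 2 * D * exp (\<gamma> * t1)"
  have "C > 0" using \<open>D > 0\<close> by (simp add: C_def)

  have decay: "opinion_diameter N y x t \<le> C * exp (- \<gamma> * t)"
    if y: "leader_trajectory r u yinit y"
      and x: "follower_trajectories N r \<tau> \<tau>0 chi \<psi> \<phi> xinit y x" and "t \<ge> t0" for y x t
  proof (rule opinion_diameter_le[OF \<open>N > 0\<close>])
    fix i assume i: "i \<in> {1..N}"
    note y_xbar = at_rest[OF y]
    have growth: "norm (x j s) < R * exp s" if "j \<in> {1..N}" "s \<ge> 0" for j s
    proof (rule follower_growth[OF x \<open>r \<ge> 0\<close> tau tau0 _ _ _ _ that])
      show "norm (y s) < R" if "-r \<le> s" for s
        using unique[OF y that] R(2)[of "z s"] that by auto
      show "norm (xinit i s) < R" if "i \<in> {1..N}" "-r \<le> s" "s \<le> 0" for i s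
      proof (rule R(2))
        have "xinit i s \<in> xinit i ` {-r..0}" using that by simp
        with \<open>i \<in> {1..N}\<close> show "xinit i s \<in> z ` {-r..} \<union> (\<Union>i\<in>{1..N}. xinit i ` {-r..0})"
          by blast
      qed
      show "0 \<le> \<phi> i w" if "i \<in> {1..N}" for i w
        using phi that less_imp_le by blast
    qed (use weight in auto)
    have start: "norm (x j s - xbar) < D" if "j \<in> {1..N}" "t0 \<le> s" "s \<le> t1" for j s
    proof -
      have "norm (x j s - xbar) \<le> norm (x j s) + norm xbar" by (rule norm_triangle_ineq4)
      also have "\<dots> < R * exp s + norm xbar" using growth[of j s] that t0 by simp
      also have "\<dots> \<le> D" using that R(1) by (simp add: D_def)
      finally show ?thesis .
    qed
    have "norm (x i t - xbar) \<le> D * exp (- \<gamma> * (t - t1))"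
    proof (cases "t \<le> t1")
      case True
      \<comment> \<open>Until \<open>t1\<close> there is no decay yet, but the claimed bound is
        still at least \<open>D\<close>.\<close>
      have "D * 1 \<le> D * exp (- \<gamma> * (t - t1))"
        using \<open>D > 0\<close> \<gamma>(1) True by (intro mult_left_mono) (auto simp: mult_nonneg_nonpos)
      then show ?thesis using start[OF i \<open>t \<ge> t0\<close> True] by simp
    next
      case False
      then show ?thesis
        using follower_decay[OF x \<open>r \<ge> 0\<close> less_imp_le[OF t0(1)] t1_def tau tau0 weight phi_ge y_xbar
            start less_imp_le[OF \<gamma>(1)] \<gamma>(2) i, of t] by simp
    qed
    also have "\<dots> = C * exp (- \<gamma> * t) / 2"
      by (simp add: C_def right_diff_distrib exp_diff exp_minus field_simps)
    finally show "norm (x i t - y t) \<le> C * exp (- \<gamma> * t) / 2"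
      using y_xbar[OF \<open>t \<ge> t0\<close>] by simp
  qed
  show ?thesis
    using u z t0(1) at_rest \<gamma>(1) \<open>C > 0\<close> decay by blast
qed

end
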